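(* Let $d\ge 1$ be an integer and let $$F(x_1,\dots,x_d) := \frac{1}{1-\left( \frac{x_1}{1+x_1} + \dots + \frac{x_d}{1+x_d} \right)},$$ which is analytic at $(0,\dots,0)$. Then the continuous multinomial is equal to $$\begin{Bmatrix} x_1+\dots+x_d \\ x_1\ ,\ \dots\ ,\ x_d \end{Bmatrix} = \frac{\partial}{\partial x_1} \cdots \frac{\partial}{\partial x_d}\, \mathcal{B}(F)(x_1,\dots,x_d),$$ where $\mathcal{B}(F)$ denotes the Borel transform of $F$.
   Context: Smirnov words: for integers $n\ge 0$, $d\ge 1$, $D(n,d)$ denotes the (finite) set of words $\mathbf c=(c_1,\dots,c_n)$ of length $n$ in the alphabet $\{1,\dots,d\}$ with no two equal consecutive letters. The frequency vector of $\mathbf c$ is $\nu=\nu(\mathbf c)=(\nu_1,\dots,\nu_d)\in\mathbb{Z}_{\ge 0}^d$, where $\nu_i$ is the number of occurrences of the letter $i$ in $\mathbf c$ (so $\nu_1+\dots+\nu_d=n$). Continuous multinomial: as a function of the real variables $x_1,\dots,x_d$, $$\begin{Bmatrix} x_1+\dots+x_d \\ x_1\ ,\ \dots\ ,\ x_d \end{Bmatrix} := \sum_{n=0}^{\infty}\ \sum_{\mathbf c \in D(n,d)} \frac{x_1^{\nu_1-1}}{(\nu_1-1)!} \cdots \frac{x_d^{\nu_d-1}}{(\nu_d-1)!},$$ where $\nu=\nu(\mathbf c)$, with the convention that a factor $\frac{x_i^{\nu_i-1}}{(\nu_i-1)!}$ with $\nu_i=0$ is $0$ (so only words using every letter contribute),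 and $x^0=1$. Borel transform: for a function analytic at the origin with power series $f(x_1,\dots,x_d)=\sum_{i_1,\dots,i_d=0}^{\infty} k_{i_1\dots i_d}\,x_1^{i_1}\cdots x_d^{i_d}$, $$\mathcal{B}(f)(x_1,\dots,x_d) := \sum_{i_1,\dots,i_d=0}^{\infty} \frac{k_{i_1 \dots i_d}}{i_1! \cdots i_d!}\, x_1^{i_1} \cdots x_d^{i_d}.$$ *)

theory Defs
  imports "HOL-Analysis.Analysis"
begin

text \<open>
  The index set \<open>{1, \<dots>, d}\<close> is an arbitrary type \<open>'d\<close> of class finite, so that
  \<open>d = CARD('d) \<ge> 1\<close>. It serves both as the alphabet and as the set of coordinates
  of \<open>real ^ 'd\<close>.
\<close>

definition smirnov_words :: "nat \<Rightarrow> 'd::finite list set" where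
  "smirnov_words n = {c. length c = n \<and> distinct_adj c}"

text \<open>The factor \<open>t^(m-1) / (m-1)!\<close>, with the convention that it vanishes for \<open>m = 0\<close>.\<close>

definition shifted_divpow :: "real \<Rightarrow> nat \<Rightarrow> real" where
  "shifted_divpow t m = (if m = 0 then 0 else t ^ (m - 1) / fact (m - 1))"

definition cont_multinomial_term :: "real ^ 'd::finite \<Rightarrow> nat \<Rightarrow> real" where
  "cont_multinomial_term x n =
     (\<Sum>c\<in>smirnov_words n. \<Prod>i\<in>UNIV. shifted_divpow (x $ i) (count_list c i))"

definition cont_multinomial :: "real ^ 'd::finite \<Rightarrow> real" where
  "cont_multinomial x = (\<Sum>n. cont_multinomial_term x n)"

definition monomial :: "real ^ 'd::finite \<Rightarrow> ('d \<Rightarrow> nat) \<Rightarrow> real" where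
  "monomial x m = (\<Prod>j\<in>UNIV. (x $ j) ^ m j)"

definition has_power_series :: "(real ^ 'd::finite \<Rightarrow> real) \<Rightarrow> (('d \<Rightarrow> nat) \<Rightarrow> real) \<Rightarrow> bool" where
  "has_power_series f k \<longleftrightarrow>
     (\<forall>\<^sub>F x in nhds 0. ((\<lambda>m. k m * monomial x m) has_sum f x) UNIV)"

definition analytic_at_origin :: "(real ^ 'd::finite \<Rightarrow> real) \<Rightarrow> bool" where
  "analytic_at_origin f \<longleftrightarrow> (\<exists>k. has_power_series f k)"

text \<open>Meaningful only for functions analytic at the origin, whose coefficients are unique.\<close>

definition power_series_coeff :: "(real ^ 'd::finite \<Rightarrow> real) \<Rightarrow> ('d \<Rightarrow> nat) \<Rightarrow> real" where
  "power_series_coeff f = (THE k. has_power_series f k)"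

definition borel_term :: "(real ^ 'd::finite \<Rightarrow> real) \<Rightarrow> real ^ 'd \<Rightarrow> ('d \<Rightarrow> nat) \<Rightarrow> real" where
  "borel_term f x m = power_series_coeff f m / (\<Prod>j\<in>UNIV. fact (m j)) * monomial x m"

definition borel_transform :: "(real ^ 'd::finite \<Rightarrow> real) \<Rightarrow> real ^ 'd \<Rightarrow> real" where
  "borel_transform f x = (\<Sum>\<^sub>\<infinity>m. borel_term f x m)"

definition partial_deriv :: "'d::finite \<Rightarrow> (real ^ 'd \<Rightarrow> real) \<Rightarrow> real ^ 'd \<Rightarrow> real" where
  "partial_deriv i f x = deriv (\<lambda>t. f (x + t *\<^sub>R axis i 1)) 0"

definition partially_differentiable :: "'d::finite \<Rightarrow> (real ^ 'd \<Rightarrow> real) \<Rightarrow> bool" where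
  "partially_differentiable i f \<longleftrightarrow>
     (\<forall>x. (\<lambda>t. f (x + t *\<^sub>R axis i 1)) differentiable (at 0))"

text \<open>For \<open>is = [i1, \<dots>, ir]\<close> the innermost derivative is the one in direction \<open>ir\<close>.\<close>

definition mixed_partial :: "'d::finite list \<Rightarrow> (real ^ 'd \<Rightarrow> real) \<Rightarrow> real ^ 'd \<Rightarrow> real" where
  "mixed_partial is f = foldr partial_deriv is f"

text \<open>All derivatives taken in forming \<open>mixed_partial is f\<close> exist, at every point.\<close>

primrec mixed_partial_exists :: "'d::finite list \<Rightarrow> (real ^ 'd \<Rightarrow> real) \<Rightarrow> bool" where
  "mixed_partial_exists [] f \<longleftrightarrow> True"
| "mixed_partial_exists (i # is) f \<longleftrightarrow>
     mixed_partial_exists is f \<and> partially_differentiable i (mixed_partial is f)"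

definition smirnov_F :: "real ^ 'd::finite \<Rightarrow> real" where
  "smirnov_F x = 1 / (1 - (\<Sum>i\<in>UNIV. x $ i / (1 + x $ i)))"

end

theory Submission
  imports Defs
begin

text \<open>
  Write \<open>W(m)\<close> for the number of Smirnov words with frequency vector \<open>m\<close>. Both sides of the
  identity turn out to be \<open>\<Sum>\<^sub>m W(m + (1,\<dots>,1)) x\<^sup>m / m!\<close>.

  On the right, the point is that \<open>F\<close> is the generating function of Smirnov words. Let
  \<open>S = \<Sum>\<^sub>c x^\<nu>(c)\<close> over all Smirnov words, and let \<open>S\<^sub>i\<close> be the part contributed by words that
  begin with \<open>i\<close>. Deleting the first letter leaves an arbitrary Smirnov word that does not begin with
  \<open>i\<close>, so \<open>S\<^sub>i = x\<^sub>i (S - S\<^sub>i)\<close>, whence \<open>S\<^sub>i = x\<^sub>i / (1 + x\<^sub>i) S\<close>; summing over \<open>i\<close> gives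
  \<open>S = 1 + (\<Sum>\<^sub>i x\<^sub>i / (1 + x\<^sub>i)) S\<close>, that is \<open>S = F(x)\<close> (\<open>smirnov_generating_function\<close>). Grouping
  the words by frequency vector turns this into the power series of \<open>F\<close>, whose coefficients \<open>W(m)\<close>
  are determined by \<open>F\<close> (\<open>has_power_series_unique\<close>). The Borel transform divides them by \<open>m!\<close>,
  which makes the series converge everywhere (\<open>entire_borel_coeff\<close>). A series that converges
  everywhere may be differentiated term by term in each variable (\<open>DERIV_power_sum\<close>), and one
  derivative in each variable moves \<open>W(m) / m!\<close> to \<open>W(m + (1,\<dots>,1)) / m!\<close>.

  On the left, group the words of the continuous multinomial by frequency vector instead of by length;
  the words that miss a letter contribute nothing, and the others are indexed by \<open>m + (1,\<dots>,1)\<close>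
  (\<open>cont_multinomial_sums\<close>). All sums converge absolutely, so the regrouping is harmless.
\<close>

section \<open>Summation over the fibres of a map\<close>

lemma has_sum_by_fibres:
  fixes f :: "'a \<Rightarrow> real"
  assumes "(f has_sum s) A" and "\<And>b. finite {a \<in> A. g a = b}"
  shows "((\<lambda>b. \<Sum>a\<in>{a \<in> A. g a = b}. f a) has_sum s) UNIV"
proof -
  let ?S = "Sigma UNIV (\<lambda>b. {a \<in> A. g a = b})"
  have "bij_betw snd ?S A"
    by (rule bij_betwI[where g = "\<lambda>a. (g a, a)"]) auto
  then have "((\<lambda>p. f (snd p)) has_sum s) ?S"
    using assms(1) by (simp add: has_sum_reindex_bij_betw)
  then show ?thesis
    by (rule has_sum_SigmaD) (simp add: assms(2))
qed

text \<open>
  A converse of the previous lemma. It needs \<open>f \<ge> 0\<close>: cancellation inside the fibres could make the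
  grouped series converge when the original one does not.
\<close>

lemma summable_on_by_fibres:
  fixes f :: "'a \<Rightarrow> real"
  assumes "\<And>b. finite {a \<in> A. g a = b}" and "\<And>a. a \<in> A \<Longrightarrow> f a \<ge> 0"
    and "(\<lambda>b. \<Sum>a\<in>{a \<in> A. g a = b}. f a) summable_on UNIV"
  shows "f summable_on A"
proof -
  let ?S = "Sigma UNIV (\<lambda>b. {a \<in> A. g a = b})"
  have bij: "bij_betw snd ?S A"
    by (rule bij_betwI[where g = "\<lambda>a. (g a, a)"]) auto
  have "(\<lambda>p. f (snd p)) summable_on ?S"
  proof (rule summable_on_SigmaI)
    show "((\<lambda>y. f (snd (b, y))) has_sum (\<Sum>a\<in>{a \<in> A. g a = b}. f a)) {a \<in> A. g a = b}" for b
      by (simp add: assms(1))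
  qed (use assms in auto)
  then show ?thesis
    using summable_on_reindex_bij_betw[OF bij, of f] by simp
qed

section \<open>Slicing a multivariate power series along one variable\<close>

text \<open>
  Letting \<open>t\<close> tend to 0 kills the constant term; dividing by \<open>t\<close> then lowers every index by one.
\<close>

lemma powser_coeff_eq_0:
  fixes a :: "nat \<Rightarrow> real"
  assumes "s > 0" and "\<And>t. t \<noteq> 0 \<Longrightarrow> \<bar>t\<bar> < s \<Longrightarrow> (\<lambda>n. a n * t ^ n) sums 0"
  shows "a n = 0"
proof -
  have const: "a 0 = 0"
    if "\<And>t. t \<noteq> 0 \<Longrightarrow> \<bar>t\<bar> < s \<Longrightarrow> (\<lambda>n. a n * t ^ n) sums 0" for a :: "nat \<Rightarrow> real"
  proof -
    have "((\<lambda>_. 0) \<longlongrightarrow> a 0) (at (0::real))"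
      by (rule powser_limit_0_strong[OF \<open>s > 0\<close>]) (use that in auto)
    then show ?thesis
      by (simp add: tendsto_const_iff)
  qed
  show ?thesis
    using assms(2)
  proof (induction n arbitrary: a)
    case 0
    then show ?case by (rule const)
  next
    case (Suc n)
    show ?case
    proof (rule Suc.IH)
      fix t :: real
      assume t: "t \<noteq> 0" "\<bar>t\<bar> < s"
      have "(\<lambda>n. a (Suc n) * t ^ Suc n) sums 0"
        using Suc.prems[OF t] const[OF Suc.prems] by (subst sums_Suc_iff) simp
      from sums_divide[OF this, of t] show "(\<lambda>n. a (Suc n) * t ^ n) sums 0"
        using t by (simp add: field_simps)
    qed
  qed
qed

definition set_coord :: "'d \<Rightarrow> real \<Rightarrow> real ^ 'd \<Rightarrow> real ^ 'd::finite" where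
  "set_coord i t x = (\<chi> j. if j = i then t else x $ j)"

lemma set_coord_nth [simp]: "set_coord i t x $ j = (if j = i then t else x $ j)"
  by (simp add: set_coord_def)

lemma set_coord_same [simp]: "set_coord i (x $ i) x = x"
  by (simp add: vec_eq_iff)

lemma add_axis_eq_set_coord: "x + t *\<^sub>R axis i 1 = set_coord i (x $ i + t) x"
  by (simp add: vec_eq_iff axis_def)

lemma monomial_split:
  "monomial x m = (x $ i) ^ m i * (\<Prod>j\<in>UNIV - {i}. (x $ j) ^ m j)"
  unfolding monomial_def by (rule prod.remove) auto

lemma monomial_upd:
  "monomial x (m(i := n)) = (x $ i) ^ n * (\<Prod>j\<in>UNIV - {i}. (x $ j) ^ m j)"
proof -
  have "(\<Prod>j\<in>UNIV - {i}. (x $ j) ^ (m(i := n)) j) = (\<Prod>j\<in>UNIV - {i}. (x $ j) ^ m j)"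
    by (rule prod.cong) auto
  then show ?thesis
    by (simp only: monomial_split[of _ _ i]) simp
qed

lemma monomial_set_coord_upd:
  "monomial (set_coord i t x) (m(i := n)) = t ^ n * monomial x (m(i := 0))"
proof -
  have "(\<Prod>j\<in>UNIV - {i}. (set_coord i t x $ j) ^ m j) = (\<Prod>j\<in>UNIV - {i}. (x $ j) ^ m j)"
    by (rule prod.cong) auto
  then show ?thesis
    by (simp add: monomial_upd)
qed

lemma abs_monomial: "\<bar>monomial x m\<bar> = monomial (\<chi> j. \<bar>x $ j\<bar>) m"
  by (simp add: monomial_def abs_prod power_abs)

definition power_sum :: "(('d::finite \<Rightarrow> nat) \<Rightarrow> real) \<Rightarrow> real ^ 'd \<Rightarrow> real" where
  "power_sum a x = (\<Sum>\<^sub>\<infinity>m. a m * monomial x m)"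

text \<open>
  Collecting the terms of \<open>\<Sum>\<^sub>m a(m) x\<^sup>m\<close> in which the variable \<open>x\<^sub>i\<close> has exponent \<open>n\<close> gives the
  coefficient of \<open>x\<^sub>i ^ n\<close>, a series in the other variables, whose exponent vectors are represented
  by those \<open>m\<close> with \<open>m i = 0\<close>.
\<close>

definition slice_coeff :: "(('d::finite \<Rightarrow> nat) \<Rightarrow> real) \<Rightarrow> 'd \<Rightarrow> real ^ 'd \<Rightarrow> nat \<Rightarrow> real" where
  "slice_coeff a i x n = (\<Sum>\<^sub>\<infinity>m\<in>{m. m i = 0}. a (m(i := n)) * monomial x m)"

text \<open>
  The slice with exponent \<open>n\<close> is a subseries of the whole series, up to the factor \<open>t ^ n\<close>. At
  \<open>t = 0\<close> this factor would hide a divergent slice, hence the assumption \<open>t \<noteq> 0\<close>.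
\<close>

lemma slice_summable:
  assumes "(\<lambda>m. a m * monomial (set_coord i t x) m) summable_on UNIV" and "t \<noteq> 0"
  shows "(\<lambda>m. a (m(i := n)) * monomial x m) summable_on {m. m i = 0}"
proof -
  have inj: "inj_on (\<lambda>m. m(i := n)) {m. m i = 0}"
    by (rule inj_onI) (metis (mono_tags) fun_upd_triv fun_upd_upd mem_Collect_eq)
  have "(\<lambda>m. a m * monomial (set_coord i t x) m) summable_on (\<lambda>m. m(i := n)) ` {m. m i = 0}"
    using assms(1) by (rule summable_on_subset_banach) simp
  then have "(\<lambda>m. t ^ n * (a (m(i := n)) * monomial x (m(i := 0)))) summable_on {m. m i = 0}"
    by (subst (asm) summable_on_reindex[OF inj]) (simp add: o_def monomial_set_coord_upd mult_ac)
  then have "(\<lambda>m. a (m(i := n)) * monomial x (m(i := 0))) summable_on {m. m i = 0}"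
    using assms(2) by (subst (asm) summable_on_cmult_right') auto
  then show ?thesis
    by (rule summable_on_cong[THEN iffD1, rotated]) (simp add: fun_upd_idem)
qed

text \<open>
  As a function of the single variable \<open>x\<^sub>i\<close>, a multivariate power series is an ordinary power series.
  This reduces both uniqueness of coefficients and differentiation to one variable.
\<close>

lemma slice_has_sum:
  assumes "(\<lambda>m. a m * monomial (set_coord i t x) m) summable_on UNIV"
    and "\<And>n. (\<lambda>m. a (m(i := n)) * monomial x m) summable_on {m. m i = 0}"
  shows "((\<lambda>n. slice_coeff a i x n * t ^ n) has_sum power_sum a (set_coord i t x)) UNIV"
proof -
  let ?f = "\<lambda>m. a m * monomial (set_coord i t x) m"
  have bij: "bij_betw (\<lambda>(n, m). m(i := n)) (UNIV \<times> {m. m i = (0::nat)}) UNIV"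
    by (rule bij_betwI[where g = "\<lambda>m. (m i, m(i := 0))"]) (auto simp: fun_eq_iff)
  have "(?f has_sum power_sum a (set_coord i t x)) UNIV"
    using assms(1) unfolding power_sum_def by simp
  then have "((\<lambda>p. ?f (case p of (n, m) \<Rightarrow> m(i := n))) has_sum power_sum a (set_coord i t x))
      (UNIV \<times> {m. m i = 0})"
    by (rule has_sum_reindex_bij_betw[OF bij, THEN iffD2])
  then show ?thesis
  proof (rule has_sum_SigmaD)
    fix n
    have "((\<lambda>m. a (m(i := n)) * monomial x m * t ^ n) has_sum slice_coeff a i x n * t ^ n) {m. m i = 0}"
      unfolding slice_coeff_def by (intro has_sum_cmult_left has_sum_infsum assms(2))
    then show "((\<lambda>m. ?f (case (n, m) of (n, m) \<Rightarrow> m(i := n))) has_sum slice_coeff a i x n * t ^ n)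
        {m. m i = 0}"
    proof (rule has_sum_cong[THEN iffD1, rotated])
      fix m :: "'a \<Rightarrow> nat" assume "m \<in> {m. m i = 0}"
      then have "m(i := 0) = m" by auto
      then show "a (m(i := n)) * monomial x m * t ^ n =
          ?f (case (n, m) of (n, m) \<Rightarrow> m(i := n))"
        by (simp add: monomial_set_coord_upd)
    qed
  qed
qed

section \<open>Uniqueness of the coefficients\<close>

text \<open>
  Induction on the set \<open>S\<close> of variables that occur: the series in one of them, \<open>x\<^sub>i\<close>, vanishes near 0,
  so each of its slice coefficients vanishes; these are power series in the variables that remain. The
  domain is a box and not a ball so that \<open>x\<^sub>i\<close> can vary independently of the other coordinates.
\<close>

lemma coeff_eq_0_if_power_sum_0:
  fixes a :: "('d::finite \<Rightarrow> nat) \<Rightarrow> real"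
  assumes "finite S" and "e > 0"
    and "\<And>x. (\<And>j. \<bar>x $ j\<bar> < e) \<Longrightarrow> ((\<lambda>m. a m * monomial x m) has_sum 0) UNIV"
    and "\<And>m j. a m \<noteq> 0 \<Longrightarrow> j \<notin> S \<Longrightarrow> m j = 0"
  shows "a m = 0"
  using assms(1,3,4)
proof (induction S arbitrary: a m)
  case empty
  have supp: "a m = 0" if "m \<noteq> (\<lambda>_. 0)" for m
    using empty(2)[of m] that by auto
  have "((\<lambda>m. a m * monomial 0 m) has_sum 0) UNIV"
    using empty(1)[of 0] assms(2) by simp
  then have "((\<lambda>m. a m * monomial 0 m) has_sum 0) {\<lambda>_. 0}"
    by (rule has_sum_cong_neutral[THEN iffD1, rotated -1]) (use supp in auto)
  from has_sum_unique[OF this has_sum_finite] have "a (\<lambda>_. 0) = 0"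
    by (simp add: monomial_def)
  then show ?case
    using supp by (cases "m = (\<lambda>_. 0)") auto
next
  case (insert i S)
  define b where "b n m = (if m i = 0 then a (m(i := n)) else 0)" for n m
  have "b n m = 0" for n m
  proof (rule insert.IH)
    fix x :: "real ^ 'd"
    assume x: "\<And>j. \<bar>x $ j\<bar> < e"
    have box: "((\<lambda>m. a m * monomial (set_coord i t x) m) has_sum 0) UNIV" if "\<bar>t\<bar> < e" for t
      using insert.prems(1) x that by simp
    have sl: "(\<lambda>m. a (m(i := n)) * monomial x m) summable_on {m. m i = 0}" for n
      using box[of "e / 2"] assms(2) by (intro slice_summable[where t = "e / 2"] has_sum_imp_summable) auto
    have "slice_coeff a i x n = 0"
    proof (rule powser_coeff_eq_0[OF assms(2)])
      fix t :: real
      assume "\<bar>t\<bar> < e"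
      from box[OF this] have "((\<lambda>n. slice_coeff a i x n * t ^ n) has_sum 0) UNIV"
        using slice_has_sum[OF _ sl, of t] by (simp add: has_sum_iff power_sum_def)
      then show "(\<lambda>n. slice_coeff a i x n * t ^ n) sums 0"
        by (rule has_sum_imp_sums)
    qed
    then have "((\<lambda>m. a (m(i := n)) * monomial x m) has_sum 0) {m. m i = 0}"
      using sl[of n] by (simp add: has_sum_iff slice_coeff_def)
    then show "((\<lambda>m. b n m * monomial x m) has_sum 0) UNIV"
      by (rule has_sum_cong_neutral[THEN iffD1, rotated -1]) (auto simp: b_def)
  next
    fix m j assume "b n m \<noteq> 0" "j \<notin> S"
    then show "m j = 0"
      using insert.prems(2)[of "m(i := n)" j]
      by (cases "j = i") (auto simp: b_def simp del: fun_upd_apply simp add: fun_upd_other split: if_splits)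
  qed
  from this[of "m i" "m(i := 0)"] show ?case
    by (simp add: b_def)
qed

lemma has_power_series_unique:
  assumes "has_power_series f k" and "has_power_series f k'"
  shows "k = k'"
proof
  fix m
  have "\<forall>\<^sub>F x in nhds 0. ((\<lambda>m. (k m - k' m) * monomial x m) has_sum 0) UNIV"
    using assms unfolding has_power_series_def
  proof eventually_elim
    case (elim x)
    have "((\<lambda>m. - (k' m * monomial x m)) has_sum - f x) UNIV"
      using elim(2) by (simp add: has_sum_uminus)
    from has_sum_add[OF elim(1) this] show ?case
      by (simp add: left_diff_distrib)
  qed
  then obtain d where d: "d > 0"
    "\<And>x. dist x 0 < d \<Longrightarrow> ((\<lambda>m. (k m - k' m) * monomial x m) has_sum 0) UNIV"
    unfolding eventually_nhds_metric by blast
  have "k m - k' m = 0"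
  proof (rule coeff_eq_0_if_power_sum_0[where a = "\<lambda>m. k m - k' m"])
    show "d / CARD('a) > 0" using d(1) by simp
    fix x :: "real ^ 'a"
    assume "\<And>j. \<bar>x $ j\<bar> < d / CARD('a)"
    then have "(\<Sum>j\<in>UNIV. \<bar>x $ j\<bar>) < of_nat (CARD('a)) * (d / CARD('a))"
      by (intro sum_bounded_above_strict) auto
    then have "dist x 0 < d"
      using norm_le_l1_cart[of x] by simp
    then show "((\<lambda>m. (k m - k' m) * monomial x m) has_sum 0) UNIV"
      by (rule d(2))
  qed (auto intro: finite_class.finite_UNIV)
  then show "k m = k' m" by simp
qed

section \<open>Termwise partial derivatives of entire power series\<close>

definition entire_series :: "(('d::finite \<Rightarrow> nat) \<Rightarrow> real) \<Rightarrow> bool" where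
  "entire_series a \<longleftrightarrow> (\<forall>x. (\<lambda>m. a m * monomial x m) summable_on UNIV)"

definition pderiv_coeff :: "'d \<Rightarrow> (('d \<Rightarrow> nat) \<Rightarrow> real) \<Rightarrow> ('d \<Rightarrow> nat) \<Rightarrow> real" where
  "pderiv_coeff i a m = real (Suc (m i)) * a (m(i := Suc (m i)))"

text \<open>
  The factor \<open>m i + 1\<close> produced by differentiation is at most \<open>2 ^ (m i + 1)\<close>, so the derived series at
  \<open>x\<close> is dominated by the original one at a point whose \<open>i\<close>-th coordinate is more than twice as large.
\<close>

lemma entire_pderiv_coeff:
  assumes "entire_series a"
  shows "entire_series (pderiv_coeff i a)"
  unfolding entire_series_def
proof
  fix x :: "real ^ 'a"
  \<comment> \<open>The summand 1 gives \<open>\<bar>x\<^sub>i\<bar> + 1 \<ge> 1\<close>, which pays for the exponent \<open>m i + 1\<close> in place of \<open>m i\<close>.\<close>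
  define y where "y = set_coord i (2 * (\<bar>x $ i\<bar> + 1)) x"
  let ?s = "\<lambda>m. m(i := Suc (m i))"
  have inj: "inj ?s"
    by (rule injI) (metis (mono_tags, lifting) Suc_inject fun_upd_eqD fun_upd_triv fun_upd_upd)
  have "(\<lambda>m. a m * monomial y m) summable_on range ?s"
    using assms unfolding entire_series_def by (blast intro: summable_on_subset_banach)
  then have "(\<lambda>m. a (?s m) * monomial y (?s m)) summable_on UNIV"
    by (simp add: summable_on_reindex[OF inj] o_def)
  then have "(\<lambda>m. norm (a (?s m) * monomial y (?s m))) summable_on UNIV"
    by (simp only: summable_on_iff_abs_summable_on_real[symmetric])
  then have "(\<lambda>m. norm (pderiv_coeff i a m * monomial x m)) summable_on UNIV"
  proof (rule Infinite_Sum.abs_summable_on_comparison_test)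
    fix m :: "'a \<Rightarrow> nat"
    let ?P = "\<Prod>j\<in>UNIV - {i}. \<bar>x $ j\<bar> ^ m j"
    have n: "real (Suc (m i)) \<le> 2 ^ Suc (m i)"
      using less_exp[of "Suc (m i)"] by (metis less_imp_le of_nat_le_iff of_nat_numeral of_nat_power)
    have "\<bar>x $ i\<bar> ^ m i \<le> (\<bar>x $ i\<bar> + 1) ^ m i"
      by (intro power_mono) auto
    also have "\<dots> \<le> (\<bar>x $ i\<bar> + 1) ^ Suc (m i)"
      by (intro power_increasing) auto
    finally have "Suc (m i) * \<bar>x $ i\<bar> ^ m i \<le> 2 ^ Suc (m i) * (\<bar>x $ i\<bar> + 1) ^ Suc (m i)"
      by (intro mult_mono n) auto
    then have "Suc (m i) * \<bar>x $ i\<bar> ^ m i * ?P \<le> (2 * (\<bar>x $ i\<bar> + 1)) ^ Suc (m i) * ?P"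
      unfolding power_mult_distrib by (intro mult_right_mono prod_nonneg) auto
    moreover have "\<bar>monomial y (?s m)\<bar> = (2 * (\<bar>x $ i\<bar> + 1)) ^ Suc (m i) * ?P"
    proof -
      have "(\<Prod>j\<in>UNIV - {i}. \<bar>y $ j\<bar> ^ m j) = ?P"
        by (rule prod.cong) (auto simp: y_def)
      moreover have "\<bar>y $ i\<bar> = 2 * (\<bar>x $ i\<bar> + 1)"
        by (simp add: y_def)
      ultimately show ?thesis
        by (simp only: monomial_upd abs_mult abs_prod power_abs)
    qed
    moreover have "\<bar>monomial x m\<bar> = \<bar>x $ i\<bar> ^ m i * ?P"
      by (simp add: monomial_split[of _ _ i] abs_mult abs_prod power_abs)
    ultimately have "Suc (m i) * \<bar>monomial x m\<bar> \<le> \<bar>monomial y (?s m)\<bar>"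
      by (simp only: mult.assoc)
    from mult_left_mono[OF this, of "\<bar>a (?s m)\<bar>"]
    show "norm (pderiv_coeff i a m * monomial x m) \<le> norm (a (?s m) * monomial y (?s m))"
      by (simp add: pderiv_coeff_def abs_mult mult_ac del: of_nat_Suc)
  qed
  then show "(\<lambda>m. pderiv_coeff i a m * monomial x m) summable_on UNIV"
    by (simp only: summable_on_iff_abs_summable_on_real[symmetric])
qed

lemma entire_slice_has_sum:
  assumes "entire_series a"
  shows "((\<lambda>n. slice_coeff a i x n * t ^ n) has_sum power_sum a (set_coord i t x)) UNIV"
  using assms unfolding entire_series_def
  by (intro slice_has_sum slice_summable[where t = 1]) auto

text \<open>
  Along the \<open>i\<close>-th axis the function is a one-variable power series with coefficients \<open>slice_coeff a i x\<close>
  and infinite radius of convergence; its termwise derivative is again a sliced series.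
\<close>

lemma DERIV_power_sum:
  assumes "entire_series a"
  shows "((\<lambda>t. power_sum a (x + t *\<^sub>R axis i 1)) has_real_derivative power_sum (pderiv_coeff i a) x) (at 0)"
proof -
  let ?c = "slice_coeff a i x"
  have sums: "(\<lambda>n. ?c n * t ^ n) sums power_sum a (set_coord i t x)" for t
    by (intro has_sum_imp_sums entire_slice_has_sum assms)
  have "slice_coeff (pderiv_coeff i a) i x n = diffs ?c n" for n
  proof -
    have "slice_coeff (pderiv_coeff i a) i x n =
        (\<Sum>\<^sub>\<infinity>m\<in>{m. m i = 0}. Suc n * (a (m(i := Suc n)) * monomial x m))"
      unfolding slice_coeff_def pderiv_coeff_def by (simp add: mult.assoc)
    also have "\<dots> = diffs ?c n"
      by (subst infsum_cmult_right') (simp add: slice_coeff_def diffs_def)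
    finally show ?thesis .
  qed
  then have "(\<lambda>n. diffs ?c n * (x $ i) ^ n) sums power_sum (pderiv_coeff i a) x"
    using has_sum_imp_sums[OF entire_slice_has_sum[OF entire_pderiv_coeff[OF assms], of i i x "x $ i"]]
    by simp
  then have "((\<lambda>t. \<Sum>n. ?c n * t ^ n) has_real_derivative power_sum (pderiv_coeff i a) x) (at (x $ i))"
    using termdiffs_strong_converges_everywhere[of ?c "x $ i"] sums
    by (simp add: sums_iff)
  then have "((\<lambda>t. power_sum a (set_coord i t x)) has_real_derivative power_sum (pderiv_coeff i a) x) (at (0 + x $ i))"
    using sums by (simp add: sums_iff)
  then show ?thesis
    unfolding add_axis_eq_set_coord add.commute[of "x $ i"] by (simp only: DERIV_shift)
qed

lemma mixed_partial_power_sum: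
  assumes "entire_series a"
  shows "mixed_partial is (power_sum a) = power_sum (foldr pderiv_coeff is a)
      \<and> entire_series (foldr pderiv_coeff is a) \<and> mixed_partial_exists is (power_sum a)"
proof (induction "is")
  case Nil
  then show ?case using assms by (simp add: mixed_partial_def)
next
  case (Cons i "is")
  let ?b = "foldr pderiv_coeff is a"
  have ent: "entire_series ?b" and eq: "mixed_partial is (power_sum a) = power_sum ?b"
    using Cons by auto
  note D = DERIV_power_sum[OF ent, of _ i]
  have "partial_deriv i (power_sum ?b) = power_sum (pderiv_coeff i ?b)"
    unfolding partial_deriv_def by (intro ext DERIV_imp_deriv D)
  moreover have "partially_differentiable i (power_sum ?b)"
    unfolding partially_differentiable_def using D real_differentiable_def by blast
  ultimately show ?case
    using Cons eq entire_pderiv_coeff[OF ent] by (simp add: mixed_partial_def)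
qed

text \<open>
  Distinctness ensures that each variable is differentiated at most once, so no exponent is raised twice.
\<close>

lemma foldr_pderiv_coeff:
  assumes "distinct is"
  shows "foldr pderiv_coeff is a m =
    (\<Prod>i\<in>set is. real (Suc (m i))) * a (\<lambda>j. if j \<in> set is then Suc (m j) else m j)"
  using assms
proof (induction "is" arbitrary: m)
  case (Cons i "is")
  have "(\<Prod>j\<in>set is. real (Suc ((m(i := Suc (m i))) j))) = (\<Prod>j\<in>set is. real (Suc (m j)))"
    using Cons.prems by (intro prod.cong) auto
  moreover have "(\<lambda>j. if j \<in> set is then Suc ((m(i := Suc (m i))) j) else (m(i := Suc (m i))) j) =
      (\<lambda>j. if j \<in> set (i # is) then Suc (m j) else m j)"
    using Cons.prems by auto
  ultimately show ?case
    using Cons by (simp add: pderiv_coeff_def mult.assoc del: of_nat_Suc)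
qed simp

section \<open>Borel transforms converge everywhere\<close>

text \<open>
  This is the product of the series of \<open>exp (y j)\<close>. Finitely many exponent vectors lie in a cube
  \<open>{0..N}\<^sup>d\<close>, over which the sum factors into partial sums of exponential series.
\<close>

lemma summable_exp_product:
  fixes y :: "'d::finite \<Rightarrow> real"
  assumes "\<And>j. y j \<ge> 0"
  shows "(\<lambda>m. \<Prod>j\<in>UNIV. y j ^ m j / fact (m j)) summable_on (UNIV :: ('d \<Rightarrow> nat) set)"
proof (rule nonneg_bdd_above_summable_on)
  show "bdd_above (sum (\<lambda>m. \<Prod>j\<in>UNIV. y j ^ m j / fact (m j)) ` {F. F \<subseteq> UNIV \<and> finite F})"
  proof (rule bdd_aboveI2)
    fix F :: "('d \<Rightarrow> nat) set"
    assume "F \<in> {F. F \<subseteq> UNIV \<and> finite F}"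
    then have fin: "finite F" by simp
    define N where "N = Max (insert 0 (\<Union>m\<in>F. range m))"
    have le: "m j \<le> N" if "m \<in> F" for m j
      unfolding N_def using that fin by (intro Max_ge) auto
    have "(\<Sum>m\<in>F. \<Prod>j\<in>UNIV. y j ^ m j / fact (m j)) \<le>
        (\<Sum>m\<in>PiE UNIV (\<lambda>_. {..N}). \<Prod>j\<in>UNIV. y j ^ m j / fact (m j))"
      using le by (intro sum_mono2 finite_PiE prod_nonneg) (auto simp: PiE_def assms)
    also have "\<dots> = (\<Prod>j\<in>UNIV. \<Sum>n\<le>N. y j ^ n / fact n)"
      by (rule prod_sum_PiE[symmetric]) auto
    also have "\<dots> \<le> (\<Prod>j\<in>UNIV. exp (y j))"
    proof (intro prod_mono conjI sum_nonneg)
      fix j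
      have "(\<Sum>n\<le>N. y j ^ n / fact n) \<le> (\<Sum>n. y j ^ n / fact n)"
        using summable_exp_generic[of "y j"] assms
        by (intro sum_le_suminf) (auto simp: divide_inverse mult.commute)
      then show "(\<Sum>n\<le>N. y j ^ n / fact n) \<le> exp (y j)"
        by (simp add: exp_def divide_inverse mult.commute)
    qed (simp add: assms)
    finally show "(\<Sum>m\<in>F. \<Prod>j\<in>UNIV. y j ^ m j / fact (m j)) \<le> (\<Prod>j\<in>UNIV. exp (y j))" .
  qed
qed (simp add: prod_nonneg assms)

text \<open>
  Convergence at the single point \<open>(r, \<dots>, r)\<close> already bounds the coefficients, \<open>\<bar>a(m)\<bar> r^\<bar>m\<bar> \<le> C\<close>, and
  dividing by \<open>m!\<close> turns this geometric growth into the product of exponential series.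
\<close>

lemma entire_borel_coeff:
  fixes a :: "('d::finite \<Rightarrow> nat) \<Rightarrow> real"
  assumes "r > 0" and "(\<lambda>m. a m * monomial (\<chi> j. r) m) summable_on UNIV"
  shows "entire_series (\<lambda>m. a m / (\<Prod>j\<in>UNIV. fact (m j)))"
  unfolding entire_series_def
proof
  fix x :: "real ^ 'd"
  let ?R = "\<chi> j::'d. r"
  define C where "C = (\<Sum>\<^sub>\<infinity>m. norm (a m * monomial ?R m))"
  have abs: "(\<lambda>m. norm (a m * monomial ?R m)) summable_on UNIV"
    using assms(2) by (simp only: summable_on_iff_abs_summable_on_real[symmetric])
  have C: "norm (a m * monomial ?R m) \<le> C" for m
    using finite_sum_le_infsum[OF abs, of "{m}"] by (simp add: C_def)
  have "(\<lambda>m. C * (\<Prod>j\<in>UNIV. (\<bar>x $ j\<bar> / r) ^ m j / fact (m j))) summable_on UNIV"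
    using assms(1) by (intro summable_on_cmult_right summable_exp_product) auto
  then have "(\<lambda>m. norm (a m / (\<Prod>j\<in>UNIV. fact (m j)) * monomial x m)) summable_on UNIV"
  proof (rule Infinite_Sum.abs_summable_on_comparison_test')
    fix m :: "'d \<Rightarrow> nat"
    let ?Q = "\<Prod>j\<in>UNIV. (\<bar>x $ j\<bar> / r) ^ m j / fact (m j)"
    have "(\<Prod>j\<in>UNIV. (\<bar>x $ j\<bar>) ^ m j / fact (m j)) = (\<Prod>j\<in>UNIV. r ^ m j * ((\<bar>x $ j\<bar> / r) ^ m j / fact (m j)))"
      using assms(1) by (intro prod.cong) (auto simp: power_divide)
    then have "norm (a m / (\<Prod>j\<in>UNIV. fact (m j)) * monomial x m) = norm (a m * monomial ?R m) * ?Q"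
      using assms(1)
      by (simp add: abs_mult abs_monomial[unfolded monomial_def] monomial_def prod.distrib prod_dividef
          abs_of_nonneg prod_nonneg)
    also have "\<dots> \<le> C * ?Q"
      using assms(1) by (intro mult_right_mono C prod_nonneg) auto
    finally show "norm (a m / (\<Prod>j\<in>UNIV. fact (m j)) * monomial x m) \<le> C * ?Q" .
  qed
  then show "(\<lambda>m. a m / (\<Prod>j\<in>UNIV. fact (m j)) * monomial x m) summable_on UNIV"
    by (simp only: summable_on_iff_abs_summable_on_real[symmetric])
qed

section \<open>The generating function of Smirnov words\<close>

definition smirnov_count :: "('d::finite \<Rightarrow> nat) \<Rightarrow> nat" where
  "smirnov_count m = card {c. distinct_adj c \<and> count_list c = m}"

lemma length_eq_sum_count_list: "length c = (\<Sum>i\<in>UNIV. count_list c (i :: 'd::finite))"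
  using sum_count_set[of c UNIV] by simp

lemma finite_lists_length: "finite {c :: 'd::finite list. length c = n}"
  using finite_lists_length_eq[of "UNIV :: 'd set" n] by simp

lemma finite_smirnov_fibre: "finite {c :: 'd::finite list. distinct_adj c \<and> count_list c = m}"
  by (rule finite_subset[OF _ finite_lists_length[of "\<Sum>i\<in>UNIV. m i"]])
     (auto simp: length_eq_sum_count_list)

lemma monomial_Cons: "monomial x (count_list (i # c)) = x $ i * monomial x (count_list c)"
proof -
  have "count_list (i # c) = (count_list c)(i := Suc (count_list c i))"
    by auto
  then show ?thesis
    by (simp only: monomial_upd monomial_split[of x "count_list c" i] power_Suc mult.assoc)
qed

lemma sum_monomial_lists:
  "(\<Sum>c | length c = n. monomial x (count_list c)) = (\<Sum>i\<in>UNIV. x $ i) ^ n"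
proof (induction n)
  case (Suc n)
  have "(\<Sum>c | length c = Suc n. monomial x (count_list c)) =
      (\<Sum>(i, c)\<in>UNIV \<times> {c. length c = n}. monomial x (count_list (i # c)))"
    by (rule sum.reindex_bij_witness[where i = "\<lambda>(i, c). i # c" and j = "\<lambda>c. (hd c, tl c)"])
       (auto simp: length_Suc_conv)
  also have "\<dots> = (\<Sum>i\<in>UNIV. x $ i) ^ Suc n"
    by (simp add: monomial_Cons sum.cartesian_product[symmetric] sum_distrib_left[symmetric]
        sum_distrib_right[symmetric] Suc)
  finally show ?case .
qed (simp add: monomial_def)

text \<open>
  Words of length \<open>n\<close> have total absolute weight \<open>(\<Sum>\<^sub>i \<bar>x\<^sub>i\<bar>) ^ n\<close>, so they are dominated by a
  geometric series.
\<close>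

lemma word_weights_summable:
  fixes x :: "real ^ 'd::finite"
  assumes "(\<Sum>i\<in>UNIV. \<bar>x $ i\<bar>) < 1"
  shows "(\<lambda>c. monomial x (count_list c)) summable_on A"
proof -
  have "(\<lambda>c. norm (monomial x (count_list c))) summable_on UNIV"
  proof (rule summable_on_by_fibres[where g = length])
    have "(\<Sum>c\<in>{c \<in> UNIV. length c = n}. norm (monomial x (count_list c))) = (\<Sum>i\<in>UNIV. \<bar>x $ i\<bar>) ^ n" for n
      using sum_monomial_lists[where n = n and x = "\<chi> j. \<bar>x $ j\<bar>"] by (simp add: abs_monomial)
    moreover have "(\<lambda>n. (\<Sum>i\<in>UNIV. \<bar>x $ i\<bar>) ^ n) summable_on UNIV"
      using assms by (subst summable_on_UNIV_nonneg_real_iff) (auto intro: summable_geometric sum_nonneg)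
    ultimately show "(\<lambda>n. \<Sum>c\<in>{c \<in> UNIV. length c = n}. norm (monomial x (count_list c))) summable_on UNIV"
      by simp
  qed (use finite_lists_length in auto)
  then have "(\<lambda>c. monomial x (count_list c)) summable_on UNIV"
    by (simp only: summable_on_iff_abs_summable_on_real[symmetric])
  then show ?thesis
    by (rule summable_on_subset_banach) simp
qed

text \<open>
  Splitting words by their first letter gives a linear equation for their total weight.
  That the total weight is an actual number with \<open>S (1 - \<Sum>\<^sub>i x\<^sub>i / (1 + x\<^sub>i)) = 1\<close> also shows that the
  denominator of \<open>smirnov_F\<close> is nonzero here.
\<close>

lemma smirnov_generating_function:
  fixes x :: "real ^ 'd::finite"
  assumes "(\<Sum>i\<in>UNIV. \<bar>x $ i\<bar>) < 1"
  shows "((\<lambda>c. monomial x (count_list c)) has_sum smirnov_F x) {c. distinct_adj c}"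
proof -
  let ?w = "\<lambda>c. monomial x (count_list c)"
  define St where "St i = {c. distinct_adj c \<and> c \<noteq> [] \<and> hd c = i}" for i :: 'd
  define S where "S = infsum ?w {c. distinct_adj c}"
  note summ = word_weights_summable[OF assms]
  have St: "infsum ?w (St i) = x $ i / (1 + x $ i) * S" for i
  proof -
    \<comment> \<open>Removing the first letter \<open>i\<close> leaves any Smirnov word, possibly empty, that does not begin with \<open>i\<close>.\<close>
    have "St i = (#) i ` ({c. distinct_adj c} - St i)"
      by (force simp: St_def distinct_adj_Cons image_iff neq_Nil_conv)
    then have "infsum ?w (St i) = infsum ?w ((#) i ` ({c. distinct_adj c} - St i))"
      by simp
    also have "\<dots> = x $ i * infsum ?w ({c. distinct_adj c} - St i)"
      by (subst infsum_reindex) (auto simp: o_def monomial_Cons infsum_cmult_right')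
    also have "infsum ?w ({c. distinct_adj c} - St i) = S - infsum ?w (St i)"
      unfolding S_def by (intro infsum_Diff summ) (auto simp: St_def)
    finally have "infsum ?w (St i) * (1 + x $ i) = x $ i * S"
      by (simp add: algebra_simps)
    moreover have "\<bar>x $ i\<bar> < 1"
      using assms member_le_sum[of i UNIV "\<lambda>i. \<bar>x $ i\<bar>"] by simp
    then have "1 + x $ i \<noteq> 0" by auto
    ultimately show ?thesis by (simp add: field_simps)
  qed
  have eq: "{c. distinct_adj c} = insert [] (\<Union>i. St i)"
    by (auto simp: St_def)
  have "S = ?w [] + infsum ?w (\<Union>i. St i)"
    unfolding S_def eq by (subst infsum_insert) (auto intro: summ simp: St_def)
  also have "infsum ?w (\<Union>i. St i) = (\<Sum>i\<in>UNIV. infsum ?w (St i))"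
    by (rule sum_infsum[symmetric]) (auto intro: summ simp: St_def)
  also have "\<dots> = (\<Sum>i\<in>UNIV. x $ i / (1 + x $ i)) * S"
    by (simp only: St sum_distrib_right)
  also have "?w [] = 1"
    by (simp add: monomial_def)
  finally have "S = 1 + (\<Sum>i\<in>UNIV. x $ i / (1 + x $ i)) * S" .
  then have *: "S * (1 - (\<Sum>i\<in>UNIV. x $ i / (1 + x $ i))) = 1"
    by (simp add: algebra_simps)
  then have "1 - (\<Sum>i\<in>UNIV. x $ i / (1 + x $ i)) \<noteq> 0" by auto
  with * have "S = smirnov_F x"
    by (simp add: smirnov_F_def field_simps)
  then show ?thesis
    using summ by (simp add: has_sum_iff S_def)
qed

lemma sum_smirnov_fibre:
  fixes f :: "('d::finite \<Rightarrow> nat) \<Rightarrow> real"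
  shows "(\<Sum>c\<in>{c \<in> {c. distinct_adj c}. count_list c = m}. f (count_list c)) = smirnov_count m * f m"
  by (simp add: smirnov_count_def)

lemma smirnov_F_expansion:
  fixes x :: "real ^ 'd::finite"
  assumes "(\<Sum>i\<in>UNIV. \<bar>x $ i\<bar>) < 1"
  shows "((\<lambda>m. smirnov_count m * monomial x m) has_sum smirnov_F x) UNIV"
  using has_sum_by_fibres[OF smirnov_generating_function[OF assms], where g = count_list]
    finite_smirnov_fibre[where ?'d = 'd] unfolding sum_smirnov_fibre by simp

section \<open>The Borel transform of the generating function and the continuous multinomial\<close>

lemma has_power_series_smirnov_F: "has_power_series smirnov_F (\<lambda>m. real (smirnov_count m))"
proof -
  have "open {x :: real ^ 'a. (\<Sum>i\<in>UNIV. \<bar>x $ i\<bar>) < 1}"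
    by (intro open_Collect_less continuous_intros)
  then have "\<forall>\<^sub>F x :: real ^ 'a in nhds 0. (\<Sum>i\<in>UNIV. \<bar>x $ i\<bar>) < 1"
    using eventually_nhds_in_open[of _ "0 :: real ^ 'a"] by fastforce
  then show ?thesis
    unfolding has_power_series_def by eventually_elim (rule smirnov_F_expansion)
qed

lemma power_series_coeff_smirnov_F: "power_series_coeff smirnov_F m = smirnov_count m"
  using the_equality[of "has_power_series smirnov_F", OF has_power_series_smirnov_F]
    has_power_series_unique[OF _ has_power_series_smirnov_F]
  unfolding power_series_coeff_def by metis

lemma entire_borel_smirnov:
  "entire_series (\<lambda>m :: 'd::finite \<Rightarrow> nat. smirnov_count m / (\<Prod>j\<in>UNIV. fact (m j)))"
proof (rule entire_borel_coeff)
  \<comment> \<open>At this point \<open>\<Sum>\<^sub>i \<bar>x\<^sub>i\<bar> = 1 / 2 < 1\<close>, inside the region where \<open>smirnov_F\<close> was expanded.\<close>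
  show "1 / (2 * CARD('d)) > (0::real)" by simp
  show "(\<lambda>m :: 'd \<Rightarrow> nat. smirnov_count m * monomial (\<chi> j. 1 / (2 * CARD('d))) m) summable_on UNIV"
    by (rule has_sum_imp_summable[OF smirnov_F_expansion]) simp
qed

lemma shifted_divpow_product:
  "(\<Prod>i\<in>UNIV. shifted_divpow (x $ i) (Suc (m i))) = monomial x m / (\<Prod>j\<in>UNIV. fact (m j))"
  by (simp add: shifted_divpow_def monomial_def prod_dividef)

text \<open>
  The series over words is regrouped twice: by length it is the continuous multinomial, by frequency
  vector it is a power series. The convention for absent letters restricts the latter to vectors of the
  form \<open>Suc \<circ> m\<close>.
\<close>

lemma cont_multinomial_sums:
  fixes x :: "real ^ 'd::finite"
  assumes "entire_series (\<lambda>m :: 'd \<Rightarrow> nat. real (smirnov_count (Suc \<circ> m)) / (\<Prod>j\<in>UNIV. fact (m j)))"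
      (is "entire_series ?b")
  shows "cont_multinomial_term x sums power_sum ?b x"
proof -
  let ?f = "\<lambda>x m. \<Prod>i\<in>UNIV. shifted_divpow (x $ i) (m i)"
  have ser: "((\<lambda>m. smirnov_count m * ?f x m) has_sum power_sum ?b x) UNIV" for x
  proof -
    have inj: "inj ((\<circ>) Suc :: ('d \<Rightarrow> nat) \<Rightarrow> _)"
      by (rule injI) (simp add: fun_eq_iff)
    have "((\<lambda>m. ?b m * monomial x m) has_sum power_sum ?b x) UNIV"
      using assms by (simp add: entire_series_def power_sum_def)
    then have "(((\<lambda>m. smirnov_count m * ?f x m) \<circ> (\<circ>) Suc) has_sum power_sum ?b x) UNIV"
      by (simp add: o_def shifted_divpow_product)
    then have "((\<lambda>m. smirnov_count m * ?f x m) has_sum power_sum ?b x) (range ((\<circ>) Suc))"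
      by (subst has_sum_reindex[OF inj])
    moreover have "?f x m = 0" if "m \<notin> range ((\<circ>) Suc)" for m
    proof -
      have "\<exists>i. m i = 0"
      proof (rule ccontr)
        assume "\<not> ?thesis"
        then have "m = Suc \<circ> (\<lambda>i. m i - 1)" by auto
        with that show False by blast
      qed
      then obtain i where "m i = 0" ..
      then have "shifted_divpow (x $ i) (m i) = 0"
        by (simp add: shifted_divpow_def)
      then show ?thesis
        by (intro prod_zero) auto
    qed
    ultimately show ?thesis
      by (subst has_sum_cong_neutral[where T = "range ((\<circ>) Suc)"]) auto
  qed
  \<comment> \<open>Absolute values turn the series at \<open>x\<close> into the one at \<open>(\<bar>x\<^sub>1\<bar>, \<dots>, \<bar>x\<^sub>d\<bar>)\<close>, which converges by \<open>ser\<close>;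
    this gives summability over words, needed before they can be grouped by length.\<close>
  let ?ax = "\<chi> j. \<bar>x $ j\<bar>"
  have norm: "norm (?f x m) = ?f ?ax m" for m
    by (simp add: abs_prod shifted_divpow_def power_abs if_distrib cong: if_cong)
  have "(\<lambda>c. norm (?f x (count_list c))) summable_on {c. distinct_adj c}"
  proof (rule summable_on_by_fibres[where g = count_list])
    show "(\<lambda>m. \<Sum>c\<in>{c \<in> {c. distinct_adj c}. count_list c = m}. norm (?f x (count_list c))) summable_on UNIV"
      unfolding norm sum_smirnov_fibre[of "?f ?ax"] using ser[of ?ax] by (rule has_sum_imp_summable)
  qed (use finite_smirnov_fibre in auto)
  then have "(\<lambda>c. ?f x (count_list c)) summable_on {c. distinct_adj c}"
    by (simp only: summable_on_iff_abs_summable_on_real[symmetric])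
  then obtain s where s: "((\<lambda>c. ?f x (count_list c)) has_sum s) {c. distinct_adj c}"
    unfolding summable_on_def by blast
  from has_sum_by_fibres[OF this, where g = count_list]
  have "((\<lambda>m. smirnov_count m * ?f x m) has_sum s) UNIV"
    using finite_smirnov_fibre[where ?'d = 'd] unfolding sum_smirnov_fibre[of "?f x"] by simp
  then have "s = power_sum ?b x"
    using ser by (rule has_sum_unique)
  moreover have "(cont_multinomial_term x has_sum s) UNIV"
  proof -
    have "smirnov_words n = {c \<in> {c :: 'd list. distinct_adj c}. length c = n}" for n
      by (auto simp: smirnov_words_def)
    moreover have "finite {c \<in> {c :: 'd list. distinct_adj c}. length c = n}" for n
      by (rule finite_subset[OF _ finite_lists_length[of n]]) auto
    ultimately show ?thesis
      using has_sum_by_fibres[OF s, where g = length]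
      unfolding cont_multinomial_term_def[abs_def] by simp
  qed
  ultimately show ?thesis
    by (simp add: has_sum_imp_sums)
qed

theorem theorem1:
  fixes vs :: "'d::finite list"
  assumes "distinct vs" and "set vs = UNIV"
  shows "analytic_at_origin (smirnov_F :: real ^ 'd \<Rightarrow> real)
       \<and> (\<forall>x :: real ^ 'd. borel_term smirnov_F x summable_on UNIV)
       \<and> mixed_partial_exists vs (borel_transform smirnov_F)
       \<and> (\<forall>x :: real ^ 'd. summable (cont_multinomial_term x))
       \<and> (\<forall>x :: real ^ 'd.
            cont_multinomial x = mixed_partial vs (borel_transform smirnov_F) x)"
proof -
  let ?a = "\<lambda>m :: 'd \<Rightarrow> nat. smirnov_count m / (\<Prod>j\<in>UNIV. fact (m j))"
  let ?b = "\<lambda>m :: 'd \<Rightarrow> nat. real (smirnov_count (Suc \<circ> m)) / (\<Prod>j\<in>UNIV. fact (m j))"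
  have borel_term: "borel_term smirnov_F x = (\<lambda>m. ?a m * monomial x m)" for x :: "real ^ 'd"
    by (simp add: fun_eq_iff borel_term_def power_series_coeff_smirnov_F)
  have borel: "borel_transform smirnov_F = power_sum ?a"
    by (simp add: fun_eq_iff borel_transform_def borel_term power_sum_def)
  have deriv: "foldr pderiv_coeff vs ?a = ?b"
  proof
    fix m :: "'d \<Rightarrow> nat"
    have "(\<Prod>j\<in>UNIV. fact (Suc (m j)) :: real) = (\<Prod>j\<in>UNIV. real (Suc (m j))) * (\<Prod>j\<in>UNIV. fact (m j))"
      by (simp only: fact_Suc prod.distrib)
    moreover have "(\<Prod>j\<in>UNIV. real (Suc (m j))) \<noteq> 0"
      by simp
    ultimately show "foldr pderiv_coeff vs ?a m = ?b m"
      by (simp add: foldr_pderiv_coeff[OF assms(1)] assms(2) o_def del: of_nat_Suc fact_Suc)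
  qed
  note mixed = mixed_partial_power_sum[OF entire_borel_smirnov, of vs, unfolded deriv]
  have sums: "cont_multinomial_term x sums power_sum ?b x" for x
    using mixed by (intro cont_multinomial_sums) simp
  show ?thesis
    using has_power_series_smirnov_F entire_borel_smirnov mixed sums
    unfolding analytic_at_origin_def borel_term borel entire_series_def cont_multinomial_def
    by (auto simp: sums_iff)
qed

end
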